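(* Let $A \in \mathbb{Z}^{m \times n}$, and let $K \subset \mathbb{R}^m$ be a closed, convex, pointed cone. Then the sequence of functions $\{F_+^k\}_{k=0}^\infty$ converges pointwise to $F_+$ on $\mathbb{R}^m$.
   Context: For $\beta^1,\beta^2\in\mathbb{R}^m$, $\beta^1 \preceq_K \beta^2$ means $\beta^2-\beta^1 \in K$. $\mathbb{Z}_+$ denotes the nonnegative integers and $1$ also denotes the all-ones vector. For $\beta\in\mathbb{R}^m$ and $k\in\mathbb{Z}_+$, let $\mathbf{P}_+(\beta)=\{x\in\mathbb{Z}^n_+ : Ax\preceq_K\beta\}$ and $\mathbf{P}_+^k(\beta)=\{x\in\mathbb{Z}^n_+ : Ax\preceq_K\beta,\ 1^Tx\le k\}$. The function $F_+:\mathbb{R}^m\to\mathbb{R}$ is defined by $F_+(\beta)=0$ if $\mathbf{P}_+(\beta)\ne\emptyset$ and $F_+(\beta)=-1$ otherwise; the function $F_+^k:\mathbb{R}^m\to\mathbb{R}$ is defined by $F_+^k(\beta)=0$ if $\mathbf{P}_+^k(\beta)\neq\emptyset$ and $F_+^k(\beta)=-1$ otherwise. *)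

theory Defs
  imports "HOL-Analysis.Analysis"
begin

definition pointed :: "'a::real_vector set \<Rightarrow> bool" where
  "pointed K \<longleftrightarrow> K \<inter> uminus ` K = {0}"

definition cone_le :: "(real^'m) set \<Rightarrow> real^'m \<Rightarrow> real^'m \<Rightarrow> bool" where
  "cone_le K \<beta>1 \<beta>2 \<longleftrightarrow> \<beta>2 - \<beta>1 \<in> K"

definition P_plus :: "real^'n^'m \<Rightarrow> (real^'m) set \<Rightarrow> real^'m \<Rightarrow> (real^'n) set" where
  "P_plus A K \<beta> = {x. (\<forall>i. x $ i \<in> \<nat>) \<and> cone_le K (A *v x) \<beta>}"

(* In the next definition, 1 :: real^'n is the all-ones vector. *)
definition P_plus_k :: "real^'n^'m \<Rightarrow> (real^'m) set \<Rightarrow> nat \<Rightarrow> real^'m \<Rightarrow> (real^'n) set" where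
  "P_plus_k A K k \<beta> =
    {x. (\<forall>i. x $ i \<in> \<nat>) \<and> cone_le K (A *v x) \<beta> \<and> (1 :: real^'n) \<bullet> x \<le> real k}"

definition F_plus :: "real^'n^'m \<Rightarrow> (real^'m) set \<Rightarrow> real^'m \<Rightarrow> real" where
  "F_plus A K \<beta> = (if P_plus A K \<beta> \<noteq> {} then 0 else - 1)"

definition F_plus_k :: "real^'n^'m \<Rightarrow> (real^'m) set \<Rightarrow> nat \<Rightarrow> real^'m \<Rightarrow> real" where
  "F_plus_k A K k \<beta> = (if P_plus_k A K k \<beta> \<noteq> {} then 0 else - 1)"

end

theory Submission
  imports Defs
begin

text \<open>For fixed \<beta> the sequence is eventually constant. The sets
  \<open>P_plus_k A K k \<beta>\<close> lie in \<open>P_plus A K \<beta>\<close> and exhaust it as k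
  grows, since every point has a finite coordinate sum. So if the latter is empty all of them are,
  and otherwise a single witness x settles every k from its coordinate sum on.\<close>

theorem proposition9:
  fixes A :: "real^'n^'m" and K :: "(real^'m) set"
  assumes "\<forall>i j. A $ i $ j \<in> \<int>"
    and "closed K" and "convex K" and "cone K" and "pointed K"
  shows "\<forall>\<beta> :: real^'m. (\<lambda>k. F_plus_k A K k \<beta>) \<longlonglongrightarrow> F_plus A K \<beta>"
proof
  fix \<beta> :: "real^'m"
  have "\<forall>\<^sub>F k in sequentially. F_plus_k A K k \<beta> = F_plus A K \<beta>"
  proof (cases "P_plus A K \<beta> = {}")
    case True
    then have "P_plus_k A K k \<beta> = {}" for k
      by (auto simp: P_plus_def P_plus_k_def)
    with True show ?thesis
      by (simp add: F_plus_def F_plus_k_def)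
  next
    case False
    then obtain x where x: "x \<in> P_plus A K \<beta>"
      by blast
    \<comment> \<open>The choice of x precedes that of k, so the bound on k depends on \<beta>
      through x, as pointwise convergence allows.\<close>
    have "\<forall>\<^sub>F k in sequentially. (1 :: real^'n) \<bullet> x \<le> real k"
      using filterlim_real_sequentially by (simp add: filterlim_at_top)
    then show ?thesis
    proof eventually_elim
      case (elim k)
      with x have "x \<in> P_plus_k A K k \<beta>"
        by (simp add: P_plus_def P_plus_k_def)
      with False show ?case
        by (auto simp: F_plus_def F_plus_k_def)
    qed
  qed
  then show "(\<lambda>k. F_plus_k A K k \<beta>) \<longlonglongrightarrow> F_plus A K \<beta>"
    by (rule tendsto_eventually)
qed

end
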